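(* Let $G$ be a connected finite loopless multigraph. For every divisor $D$ on $G$ and every vertex $q$ of $G$, there exists a $q$-reduced divisor $E$ linearly equivalent to $D$. Equivalently, there exist a superstable configuration $c$ with respect to $q$ and an integer $k$ such that $D\sim c-kq$.
   Context: A finite loopless multigraph $G$ has a finite nonempty vertex set $V=V(G)$ and a finite multiset $E(G)$ of unordered pairs $\{v,w\}$ of vertices with $v\neq w$. $G$ is connected if for every nonempty proper subset $S\subsetneq V$ there is at least one edge between $S$ and $V\setminus S$. A divisor on $G$ is a function $D:V\to\mathbb{Z}$; divisors form the abelian group $\mathbb{Z}^V$. Firing a vertex $v$ means sending one chip along each edge incident to $v$: $D(v)$ decreases by the number of edges incident to $v$ (with multiplicity) and $D(w)$ increases by the number of edges between $v$ and $w$ for each $w\neq v$. The firing vector of $v$ is the divisor that firing $v$ adds. The principal divisors are the subgroup generated by all firing vectors; $D\sim D'$ (linear equivalence) means $D-D'$ is principal. Set-firing $S\subseteq V$ means firing every vertex of $S$ exactly once; its net effect is to send one chip along each edge from $S$ to $V\setminus S$. A divisor $D$ is $q$-reduced if $D(v)\ge 0$ for all $v\ne q$ and, for every nonempty $S\subseteq V\setminus\{q\}$, set-firing $S$ creates debt somewhere, i.e. the resulting divisor is negative at some vertex of $S$. A configuration with respect to $q$ is a function $c:V\setminus\{q\}\to\mathbb{Z}_{\ge 0}$ (a divisor without debt away from $q$, forgetting the value at $q$). It is superstable if for every nonempty $S\subseteq V\setminus\{q\}$, set-firing $S$ makes the value at some vertex of $S$ negative, i.e. there is $v\in S$ such that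 $c(v)$ is less than the number of edges from $v$ to $V\setminus S$. For an integer $k$, $c-kq$ denotes the divisor equal to $c(v)$ at each $v\ne q$ and equal to $-k$ at $q$. *)

theory Defs
  imports "HOL-Algebra.Product_Groups" "HOL-Library.Multiset"
begin

text \<open>
  A multigraph is a vertex set \<open>V\<close> together with a multiset \<open>E\<close> of edges, each edge being
  a two-element set of vertices; parallel edges are counted by the multiplicity in \<open>E\<close>.
\<close>

definition loopless_multigraph :: "'a set \<Rightarrow> 'a set multiset \<Rightarrow> bool" where
  "loopless_multigraph V E \<longleftrightarrow>
     finite V \<and> V \<noteq> {} \<and> (\<forall>e. e \<in># E \<longrightarrow> (\<exists>v\<in>V. \<exists>w\<in>V. v \<noteq> w \<and> e = {v, w}))"

definition edges_between :: "'a set multiset \<Rightarrow> 'a set \<Rightarrow> 'a set \<Rightarrow> 'a set multiset" where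
  "edges_between E A B = {#e \<in># E. \<exists>a\<in>A. \<exists>b\<in>B. e = {a, b}#}"

definition connected_multigraph :: "'a set \<Rightarrow> 'a set multiset \<Rightarrow> bool" where
  "connected_multigraph V E \<longleftrightarrow>
     (\<forall>S. S \<noteq> {} \<and> S \<subset> V \<longrightarrow> edges_between E S (V - S) \<noteq> {#})"

text \<open>
  Divisors are functions on \<open>V\<close>, represented extensionally (with value \<open>undefined\<close>
  outside \<open>V\<close>), so that equality of divisors is equality on \<open>V\<close>.
\<close>

definition divisor_group :: "'a set \<Rightarrow> ('a \<Rightarrow> int) monoid" where
  "divisor_group V = product_group V (\<lambda>_. integer_group)"

definition firing_vector :: "'a set \<Rightarrow> 'a set multiset \<Rightarrow> 'a \<Rightarrow> 'a \<Rightarrow> int" where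
  "firing_vector V E v =
     (\<lambda>w\<in>V. if w = v then - int (size {#e \<in># E. v \<in> e#}) else int (count E {v, w}))"

definition principal_divisors :: "'a set \<Rightarrow> 'a set multiset \<Rightarrow> ('a \<Rightarrow> int) set" where
  "principal_divisors V E = generate (divisor_group V) (firing_vector V E ` V)"

definition linearly_equivalent ::
    "'a set \<Rightarrow> 'a set multiset \<Rightarrow> ('a \<Rightarrow> int) \<Rightarrow> ('a \<Rightarrow> int) \<Rightarrow> bool" where
  "linearly_equivalent V E D D' \<longleftrightarrow>
     D \<in> carrier (divisor_group V) \<and> D' \<in> carrier (divisor_group V) \<and>
     D \<otimes>\<^bsub>divisor_group V\<^esub> inv\<^bsub>divisor_group V\<^esub> D' \<in> principal_divisors V E"

definition set_fire ::
    "'a set \<Rightarrow> 'a set multiset \<Rightarrow> 'a set \<Rightarrow> ('a \<Rightarrow> int) \<Rightarrow> 'a \<Rightarrow> int" where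
  "set_fire V E S D = (\<lambda>w\<in>V. D w + (\<Sum>v\<in>S. firing_vector V E v w))"

definition q_reduced :: "'a set \<Rightarrow> 'a set multiset \<Rightarrow> 'a \<Rightarrow> ('a \<Rightarrow> int) \<Rightarrow> bool" where
  "q_reduced V E q D \<longleftrightarrow>
     D \<in> carrier (divisor_group V) \<and> (\<forall>v\<in>V - {q}. D v \<ge> 0) \<and>
     (\<forall>S. S \<noteq> {} \<and> S \<subseteq> V - {q} \<longrightarrow> (\<exists>v\<in>S. set_fire V E S D v < 0))"

definition configurations :: "'a set \<Rightarrow> 'a \<Rightarrow> ('a \<Rightarrow> nat) set" where
  "configurations V q = (V - {q}) \<rightarrow>\<^sub>E UNIV"

text \<open>
  For \<open>v \<in> S\<close>, set-firing \<open>S\<close> lowers the value at \<open>v\<close> by the number of edges from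
  \<open>v\<close> to \<open>V - S\<close> (lemma \<open>set_fire_inside\<close> below), so the value at \<open>v\<close> becomes negative
  exactly if \<open>c v\<close> is smaller than that number.
\<close>

definition superstable :: "'a set \<Rightarrow> 'a set multiset \<Rightarrow> 'a \<Rightarrow> ('a \<Rightarrow> nat) \<Rightarrow> bool" where
  "superstable V E q c \<longleftrightarrow>
     c \<in> configurations V q \<and>
     (\<forall>S. S \<noteq> {} \<and> S \<subseteq> V - {q} \<longrightarrow> (\<exists>v\<in>S. c v < size (edges_between E {v} (V - S))))"

text \<open>The divisor \<open>c - kq\<close>.\<close>

definition config_divisor :: "'a set \<Rightarrow> 'a \<Rightarrow> ('a \<Rightarrow> nat) \<Rightarrow> int \<Rightarrow> 'a \<Rightarrow> int" where
  "config_divisor V q c k = (\<lambda>v\<in>V. if v = q then - k else int (c v))"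

lemma size_edges_between:
  assumes "finite B" "a \<notin> B"
  shows "size (edges_between E {a} B) = (\<Sum>b\<in>B. count E {a, b})"
proof (induction E)
  case empty
  show ?case by (simp add: edges_between_def)
next
  case (add e E)
  have "(\<Sum>b\<in>B. if e = {a, b} then 1 else 0) = (if \<exists>b\<in>B. e = {a, b} then 1 else 0 :: nat)"
  proof (cases "\<exists>b\<in>B. e = {a, b}")
    case True
    then obtain b where b: "b \<in> B" "e = {a, b}" by blast
    have "(\<Sum>x\<in>B. if e = {a, x} then 1 else 0) = (\<Sum>x\<in>B. if x = b then 1 else 0 :: nat)"
      using b by (intro sum.cong) (auto simp: doubleton_eq_iff)
    then show ?thesis using b assms by auto
  qed (auto intro!: sum.neutral)
  moreover have "(\<Sum>b\<in>B. count (add_mset e E) {a, b}) =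
      (\<Sum>b\<in>B. if e = {a, b} then 1 else 0) + (\<Sum>b\<in>B. count E {a, b})"
    unfolding sum.distrib[symmetric] by (intro sum.cong) auto
  ultimately show ?case
    using add.IH by (simp add: edges_between_def)
qed

lemma incident_edges:
  assumes "loopless_multigraph V E" "v \<in> V"
  shows "{#e \<in># E. v \<in> e#} = edges_between E {v} (V - {v})"
  unfolding edges_between_def using assms
  by (intro filter_mset_cong refl) (force simp: loopless_multigraph_def doubleton_eq_iff)

text \<open>Set-firing \<open>S\<close> sends one chip along each edge from \<open>S\<close> to \<open>V - S\<close>.\<close>

lemma set_fire_inside:
  assumes G: "loopless_multigraph V E" and S: "S \<subseteq> V" and v: "v \<in> S"
  shows "set_fire V E S D v = D v - int (size (edges_between E {v} (V - S)))"
proof -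
  have fin: "finite V" "finite S"
    using G S by (auto simp: loopless_multigraph_def intro: finite_subset)
  have vV: "v \<in> V" using S v by blast
  have "size {#e \<in># E. v \<in> e#} = (\<Sum>w\<in>V - {v}. count E {v, w})"
    using incident_edges[OF G vV] size_edges_between[of "V - {v}" v E] fin by simp
  also have "V - {v} = (S - {v}) \<union> (V - S)" using S v by blast
  also have "(\<Sum>w\<in>(S - {v}) \<union> (V - S). count E {v, w}) =
      (\<Sum>w\<in>S - {v}. count E {v, w}) + (\<Sum>w\<in>V - S. count E {v, w})"
    using fin by (intro sum.union_disjoint) auto
  also have "(\<Sum>w\<in>V - S. count E {v, w}) = size (edges_between E {v} (V - S))"
    using size_edges_between[of "V - S" v E] fin v by simp
  finally have deg: "size {#e \<in># E. v \<in> e#} =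
      (\<Sum>w\<in>S - {v}. count E {v, w}) + size (edges_between E {v} (V - S))" .
  have "(\<Sum>w\<in>S. firing_vector V E w v) =
      firing_vector V E v v + (\<Sum>w\<in>S - {v}. firing_vector V E w v)"
    using fin v by (intro sum.remove)
  also have "(\<Sum>w\<in>S - {v}. firing_vector V E w v) = (\<Sum>w\<in>S - {v}. int (count E {v, w}))"
    using vV by (intro sum.cong) (auto simp: firing_vector_def insert_commute)
  finally show ?thesis
    using vV by (simp add: set_fire_def firing_vector_def deg)
qed

lemma set_fire_outside:
  assumes G: "loopless_multigraph V E" and S: "S \<subseteq> V" and v: "v \<in> V - S"
  shows "set_fire V E S D v = D v + int (size (edges_between E S {v}))"
proof -
  have "finite S" using G S by (auto simp: loopless_multigraph_def intro: finite_subset)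
  moreover have "edges_between E S {v} = edges_between E {v} S"
    unfolding edges_between_def by (intro filter_mset_cong refl) (auto simp: insert_commute)
  ultimately have "size (edges_between E S {v}) = (\<Sum>w\<in>S. count E {v, w})"
    using size_edges_between[of S v E] v by simp
  moreover have "(\<Sum>w\<in>S. firing_vector V E w v) = (\<Sum>w\<in>S. int (count E {v, w}))"
    using v by (intro sum.cong) (auto simp: firing_vector_def insert_commute)
  ultimately show ?thesis using v by (simp add: set_fire_def)
qed

end

theory Submission
  imports Defs
begin

text \<open>
  Everything is expressed through the graph Laplacian \<open>L\<close>: firing each vertex \<open>v\<close> exactly \<open>s v\<close>
  times (backwards if \<open>s v < 0\<close>) turns a divisor \<open>D\<close> into \<open>D - L s\<close>, so the divisors obtained this
  way are linearly equivalent to \<open>D\<close> (\<open>linearly_equivalent_laplacian\<close>), and set-firing \<open>S\<close> is the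
  case in which \<open>s\<close> is the indicator function of \<open>S\<close>.

  The proof rests on one auxiliary function: a \<open>b\<close> on the vertices that attains its minimum at \<open>q\<close>
  and satisfies \<open>L b > 0\<close> at every other vertex (\<open>strictly_superharmonic_exists\<close>). This is
  where connectedness enters. After subtracting a constant, \<open>b q = 0\<close>, and \<open>b\<close> serves twice.

  As a firing script, it removes debt: firing \<open>- k * b\<close> adds at least \<open>k\<close> chips to each vertex
  other than \<open>q\<close>, so for large \<open>k\<close> all debt sits at \<open>q\<close>.

  As a weight, it forbids firing forever: the energy \<open>\<Sum>v. b v * D v\<close> is nonnegative when \<open>D\<close> is out
  of debt away from \<open>q\<close>, and by symmetry of \<open>L\<close>, firing a set \<open>S\<close> lowers it by
  \<open>\<Sum>v\<in>S. L b v\<close>, which is positive for nonempty \<open>S\<close> avoiding \<open>q\<close>. Hence a divisor of least energy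
  among those of the form \<open>D - L s\<close> without debt away from \<open>q\<close> admits no legal set-firing, which
  is what being \<open>q\<close>-reduced means. Restricting it to \<open>V - {q}\<close> gives the superstable
  configuration.
\<close>

section \<open>The Laplacian as the net effect of firing\<close>

definition laplacian :: "'a set \<Rightarrow> 'a set multiset \<Rightarrow> ('a \<Rightarrow> int) \<Rightarrow> 'a \<Rightarrow> int" where
  "laplacian V E s v = (\<Sum>w\<in>V. int (count E {v, w}) * (s v - s w))"

lemma laplacian_add:
  "laplacian V E (\<lambda>v. s v + t v) w = laplacian V E s w + laplacian V E t w"
  unfolding laplacian_def sum.distrib[symmetric]
  by (intro sum.cong) (auto simp: algebra_simps)

lemma laplacian_scale:
  "laplacian V E (\<lambda>v. k * s v) w = k * laplacian V E s w"
  unfolding laplacian_def sum_distrib_left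
  by (intro sum.cong) (auto simp: algebra_simps)

lemma laplacian_symmetric:
  "(\<Sum>v\<in>V. s v * laplacian V E t v) = (\<Sum>v\<in>V. t v * laplacian V E s v)"
proof -
  have "(\<Sum>v\<in>V. \<Sum>w\<in>V. int (count E {v, w}) * s v * t w)
      = (\<Sum>v\<in>V. \<Sum>w\<in>V. int (count E {w, v}) * s w * t v)"
    by (rule sum.swap)
  then show ?thesis
    by (simp add: laplacian_def sum_distrib_left sum_subtractf algebra_simps insert_commute)
qed

lemma laplacian_shift:
  "laplacian V E (\<lambda>v. s v - k) w = laplacian V E s w"
  by (simp add: laplacian_def)

lemma laplacian_indicator_other:
  assumes "finite V" "u \<in> V" "v \<noteq> u"
  shows "laplacian V E (\<lambda>w. of_bool (w = u)) v = - int (count E {v, u})"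
proof -
  have "laplacian V E (\<lambda>w. of_bool (w = u)) v
      = (\<Sum>w\<in>V. if w = u then - int (count E {v, u}) else 0)"
    unfolding laplacian_def using assms(3) by (intro sum.cong) auto
  then show ?thesis using assms(1,2) by simp
qed

lemma firing_vector_laplacian:
  assumes G: "loopless_multigraph V E" and u: "u \<in> V" and w: "w \<in> V"
  shows "firing_vector V E u w = - laplacian V E (\<lambda>v. of_bool (v = u)) w"
proof (cases "w = u")
  case True
  have fin: "finite V" using G by (simp add: loopless_multigraph_def)
  have "size {#e \<in># E. u \<in> e#} = (\<Sum>v\<in>V - {u}. count E {u, v})"
    using incident_edges[OF G u] size_edges_between[of "V - {u}" u E] fin by simp
  also have "int \<dots> = laplacian V E (\<lambda>v. of_bool (v = u)) u"
    unfolding laplacian_def using fin u by (subst (2) sum.remove) auto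
  finally show ?thesis using True u by (simp add: firing_vector_def)
next
  case False
  then show ?thesis
    using laplacian_indicator_other[of V u w E] G u w
    by (simp add: firing_vector_def loopless_multigraph_def insert_commute)
qed

text \<open>
  By linearity from \<open>firing_vector_laplacian\<close>, because \<open>s\<close> is the combination of the indicator
  functions of single vertices with coefficients \<open>s u\<close>.
\<close>

lemma sum_firing_vectors:
  assumes G: "loopless_multigraph V E" and w: "w \<in> V"
  shows "(\<Sum>u\<in>V. s u * firing_vector V E u w) = - laplacian V E s w"
proof -
  have fin: "finite V" using G by (simp add: loopless_multigraph_def)
  let ?d = "\<lambda>u v. of_bool (v = u) :: int"
  have "(\<Sum>u\<in>V. s u * firing_vector V E u w) = - (\<Sum>u\<in>V. s u * laplacian V E (?d u) w)"
    using G w by (simp add: firing_vector_laplacian sum_negf)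
  also have "(\<Sum>u\<in>V. s u * laplacian V E (?d u) w)
      = (\<Sum>u\<in>V. \<Sum>v\<in>V. int (count E {w, v}) * (s u * ?d u w - s u * ?d u v))"
    by (simp add: laplacian_def sum_distrib_left algebra_simps)
  also have "\<dots> = (\<Sum>v\<in>V. \<Sum>u\<in>V. int (count E {w, v}) * (s u * ?d u w - s u * ?d u v))"
    by (rule sum.swap)
  also have "\<dots> = laplacian V E s w"
    unfolding laplacian_def
  proof (rule sum.cong)
    fix v assume v: "v \<in> V"
    have pick: "(\<Sum>u\<in>V. s u * ?d u x) = s x" if "x \<in> V" for x
      using fin that by (simp add: of_bool_def if_distrib cong: if_cong)
    show "(\<Sum>u\<in>V. int (count E {w, v}) * (s u * ?d u w - s u * ?d u v))
        = int (count E {w, v}) * (s w - s v)"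
      unfolding sum_distrib_left[symmetric] sum_subtractf pick[OF v] pick[OF w] ..
  qed simp
  finally show ?thesis .
qed

lemma set_fire_laplacian:
  assumes G: "loopless_multigraph V E" and S: "S \<subseteq> V" and w: "w \<in> V"
  shows "set_fire V E S D w = D w - laplacian V E (\<lambda>v. of_bool (v \<in> S)) w"
proof -
  have fin: "finite V" using G by (simp add: loopless_multigraph_def)
  have "(\<Sum>v\<in>S. firing_vector V E v w) = (\<Sum>v\<in>V. of_bool (v \<in> S) * firing_vector V E v w)"
    using fin S by (intro sum.mono_neutral_cong_left) auto
  then show ?thesis
    using sum_firing_vectors[OF G w] w by (simp add: set_fire_def)
qed

section \<open>Images of the Laplacian are principal\<close>

lemma divisor_group_simps:
  "carrier (divisor_group V) = extensional V"
  "D \<otimes>\<^bsub>divisor_group V\<^esub> D' = (\<lambda>v\<in>V. D v + D' v)"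
  "\<one>\<^bsub>divisor_group V\<^esub> = (\<lambda>v\<in>V. 0)"
  by (auto simp: divisor_group_def product_group_def PiE_def)

lemma group_divisor_group: "group (divisor_group V)"
  by (simp add: divisor_group_def)

lemma inv_divisor_group:
  "D \<in> extensional V \<Longrightarrow> inv\<^bsub>divisor_group V\<^esub> D = (\<lambda>v\<in>V. - D v)"
  by (rule group.inv_equality[OF group_divisor_group])
    (auto simp: divisor_group_simps)

lemma subgroup_divisor_group_scale:
  assumes H: "subgroup H (divisor_group V)" and f: "f \<in> H"
  shows "(\<lambda>v\<in>V. k * f v) \<in> H"
proof (induction k rule: int_induct[where k = 0])
  case base
  show ?case using subgroup.one_closed[OF H] by (simp only: divisor_group_simps mult_zero_left)
next
  case (step1 i)
  have "(\<lambda>v\<in>V. i * f v) \<otimes>\<^bsub>divisor_group V\<^esub> f = (\<lambda>v\<in>V. (i + 1) * f v)"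
    by (auto simp: divisor_group_simps fun_eq_iff algebra_simps)
  then show ?case using subgroup.m_closed[OF H step1(2) f] by (simp only:)
next
  case (step2 i)
  have "f \<in> extensional V"
    using subgroup.mem_carrier[OF H f] by (simp add: divisor_group_simps)
  then have "(\<lambda>v\<in>V. - f v) \<in> H"
    using subgroup.m_inv_closed[OF H f] by (simp add: inv_divisor_group)
  moreover have "(\<lambda>v\<in>V. i * f v) \<otimes>\<^bsub>divisor_group V\<^esub> (\<lambda>v\<in>V. - f v) = (\<lambda>v\<in>V. (i - 1) * f v)"
    by (auto simp: divisor_group_simps fun_eq_iff algebra_simps)
  ultimately show ?case using subgroup.m_closed[OF H step2(2)] by metis
qed

lemma laplacian_principal:
  assumes G: "loopless_multigraph V E"
  shows "(\<lambda>w\<in>V. laplacian V E s w) \<in> principal_divisors V E"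
proof -
  have fin: "finite V" using G by (simp add: loopless_multigraph_def)
  let ?P = "principal_divisors V E"
  have H: "subgroup ?P (divisor_group V)"
    unfolding principal_divisors_def
    by (rule group.generate_is_subgroup[OF group_divisor_group])
      (auto simp: divisor_group_simps firing_vector_def)
  have "(\<lambda>w\<in>V. \<Sum>u\<in>A. - s u * firing_vector V E u w) \<in> ?P" if "finite A" "A \<subseteq> V" for A
    using that
  proof (induction A rule: finite_induct)
    case empty
    show ?case using subgroup.one_closed[OF H] by (simp only: divisor_group_simps sum.empty)
  next
    case (insert u A)
    have "firing_vector V E u \<in> ?P"
      using insert.prems by (auto simp: principal_divisors_def intro: generate.incl)
    then have "(\<lambda>w\<in>V. - s u * firing_vector V E u w) \<in> ?P"
      by (rule subgroup_divisor_group_scale[OF H])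
    moreover have "(\<lambda>w\<in>V. \<Sum>u\<in>A. - s u * firing_vector V E u w) \<in> ?P"
      by (rule insert.IH) (use insert.prems in blast)
    ultimately have "(\<lambda>w\<in>V. - s u * firing_vector V E u w) \<otimes>\<^bsub>divisor_group V\<^esub>
        (\<lambda>w\<in>V. \<Sum>u\<in>A. - s u * firing_vector V E u w) \<in> ?P"
      by (rule subgroup.m_closed[OF H])
    moreover have "(\<lambda>w\<in>V. - s u * firing_vector V E u w) \<otimes>\<^bsub>divisor_group V\<^esub>
        (\<lambda>w\<in>V. \<Sum>u\<in>A. - s u * firing_vector V E u w)
        = (\<lambda>w\<in>V. \<Sum>u\<in>insert u A. - s u * firing_vector V E u w)"
      using insert.hyps by (auto simp: divisor_group_simps fun_eq_iff)
    ultimately show ?case by (simp only:)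
  qed
  from this[OF fin subset_refl]
  have "(\<lambda>w\<in>V. \<Sum>u\<in>V. - s u * firing_vector V E u w) \<in> ?P" .
  moreover have "(\<lambda>w\<in>V. \<Sum>u\<in>V. - s u * firing_vector V E u w) = (\<lambda>w\<in>V. laplacian V E s w)"
    using sum_firing_vectors[OF G, of _ s] by (intro restrict_ext) (simp add: sum_negf)
  ultimately show ?thesis by simp
qed

lemma linearly_equivalent_laplacian:
  assumes "loopless_multigraph V E" "D \<in> carrier (divisor_group V)"
  shows "linearly_equivalent V E D (\<lambda>w\<in>V. D w - laplacian V E s w)"
proof -
  let ?D' = "\<lambda>w\<in>V. D w - laplacian V E s w"
  have "D \<otimes>\<^bsub>divisor_group V\<^esub> inv\<^bsub>divisor_group V\<^esub> ?D' = (\<lambda>w\<in>V. laplacian V E s w)"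
    by (auto simp: divisor_group_simps inv_divisor_group fun_eq_iff)
  then show ?thesis
    using assms(2) laplacian_principal[OF assms(1), of s]
    by (simp add: linearly_equivalent_def divisor_group_simps)
qed

section \<open>A strictly superharmonic function\<close>

text \<open>
  Take a superharmonic function (\<open>L b \<ge> 0\<close> away from \<open>q\<close>) with minimum at \<open>q\<close> whose set \<open>Z\<close> of
  vertices \<open>v \<noteq> q\<close> with \<open>L b v = 0\<close> is as small as possible; the zero function shows that there is
  one. If \<open>Z\<close> were nonempty, connectedness would give an edge from some \<open>w \<in> Z\<close> to some
  \<open>u \<notin> Z\<close>. Lowering \<open>b\<close> at \<open>u\<close> makes \<open>L b w\<close> positive and decreases \<open>L b\<close> nowhere
  except at \<open>u\<close>. If \<open>u \<noteq> q\<close>, then \<open>L b u\<close> was positive, and scaling \<open>b\<close> up beforehand keeps it so.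
  Thus \<open>Z\<close> could be made smaller.
\<close>

lemma strictly_superharmonic_exists:
  assumes G: "loopless_multigraph V E" and C: "connected_multigraph V E" and q: "q \<in> V"
  shows "\<exists>b. (\<forall>v\<in>V. b q \<le> b v) \<and> (\<forall>v\<in>V - {q}. laplacian V E b v > 0)"
proof -
  have fin: "finite V" using G by (simp add: loopless_multigraph_def)
  let ?L = "laplacian V E"
  let ?Z = "\<lambda>b. {v \<in> V - {q}. ?L b v = 0}"
  define good where "good b \<longleftrightarrow> (\<forall>v\<in>V. b q \<le> b v) \<and> (\<forall>v\<in>V - {q}. ?L b v \<ge> 0)" for b
  have improve: "\<exists>b'. good b' \<and> card (?Z b') < card (?Z b)" if b: "good b" and Z: "?Z b \<noteq> {}" for b
  proof -
    have "?Z b \<subset> V" using q by blast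
    with Z have "edges_between E (?Z b) (V - ?Z b) \<noteq> {#}"
      using C[unfolded connected_multigraph_def, THEN spec, of "?Z b"] by (simp only: simp_thms)
    then obtain e where "e \<in># edges_between E (?Z b) (V - ?Z b)"
      by (rule multiset_nonemptyE)
    then have "e \<in># E" "\<exists>w\<in>?Z b. \<exists>u\<in>V - ?Z b. e = {w, u}"
      by (simp_all only: edges_between_def set_mset_filter mem_Collect_eq)
    then obtain w u where w: "w \<in> ?Z b" and u: "u \<in> V" "u \<notin> ?Z b" and wu: "{w, u} \<in># E"
      by blast
    let ?d = "\<lambda>u v. of_bool (v = u) :: int"
    \<comment> \<open>The factor \<open>M\<close> exceeds the loss of \<open>L b u\<close> caused by lowering \<open>b\<close> at \<open>u\<close>. The value at \<open>q\<close> is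
      lowered as well so that the minimum stays at \<open>q\<close> even if \<open>b u = b q\<close>; this never lowers
      \<open>L b\<close> at the other vertices.\<close>
    define M where "M = \<bar>?L (?d u) u\<bar> + 1"
    define b' where "b' = (\<lambda>v. M * b v + (- 1 * ?d u v + - 1 * ?d q v))"
    have L': "?L b' v = M * ?L b v - ?L (?d u) v - ?L (?d q) v" for v
      unfolding b'_def laplacian_add laplacian_scale by simp
    have M: "M > 0" by (simp add: M_def)
    have Lq: "?L (?d q) v \<le> 0" if "v \<noteq> q" for v
      using laplacian_indicator_other[OF fin q that] by simp
    have Lu: "?L (?d u) v \<le> 0" if "v \<noteq> u" for v
      using laplacian_indicator_other[OF fin u(1) that] by simp
    have nonneg: "?L b v \<ge> 0" if "v \<in> V - {q}" for v
      using b that by (simp add: good_def)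
    have pos: "?L b' v > 0" if v: "v \<in> V - {q}" and "?L b v > 0" for v
    proof (cases "v = u")
      case True
      have "M \<le> M * ?L b u" using mult_left_mono[of 1 "?L b u" M] that M True by simp
      moreover have "?L (?d q) u \<le> 0" using Lq[of u] v True by blast
      ultimately show ?thesis unfolding L' True using M_def by linarith
    next
      case False
      have "M * ?L b v > 0" using that M by simp
      then show ?thesis using Lq[of v] Lu[of v] v False by (simp add: L')
    qed
    have stay: "?L b' v \<ge> 0" if v: "v \<in> V - {q}" and "?L b v = 0" for v
    proof -
      have "v \<noteq> u" using that u by auto
      then show ?thesis using Lq[of v] Lu[of v] that by (simp add: L')
    qed
    have wpos: "?L b' w > 0"
    proof -
      have "w \<noteq> u" "w \<noteq> q" "?L b w = 0" using w u by auto
      then have "?L b' w \<ge> int (count E {w, u})"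
        using Lq[of w] laplacian_indicator_other[OF fin u(1), of w E] by (simp add: L')
      moreover have "count E {w, u} > 0" using wu by simp
      ultimately show ?thesis by linarith
    qed
    have "b' q \<le> b' v" if "v \<in> V" for v
    proof -
      have "M * b q \<le> M * b v" using b M that by (simp add: good_def)
      then show ?thesis by (auto simp: b'_def)
    qed
    moreover have "?L b' v \<ge> 0" if "v \<in> V - {q}" for v
      using pos[OF that] stay[OF that] nonneg[OF that] by linarith
    ultimately have good: "good b'" by (simp add: good_def)
    have "?L b v = 0" if "v \<in> V - {q}" "?L b' v = 0" for v
      using pos[OF that(1)] nonneg[OF that(1)] that(2) by linarith
    then have "?Z b' \<subseteq> ?Z b" by blast
    moreover have "w \<notin> ?Z b'" using wpos by simp
    ultimately have "?Z b' \<subset> ?Z b" using w by blast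
    then have "card (?Z b') < card (?Z b)" using fin by (intro psubset_card_mono) auto
    with good show ?thesis by (intro exI conjI)
  qed
  have "good (\<lambda>_. 0)" by (simp add: good_def laplacian_def)
  then obtain b where b: "good b" and min: "\<And>b'. good b' \<Longrightarrow> card (?Z b) \<le> card (?Z b')"
    using ex_has_least_nat[of good "\<lambda>_. 0" "\<lambda>b. card (?Z b)"] by blast
  have "?Z b = {}"
  proof (rule ccontr)
    assume "?Z b \<noteq> {}"
    from improve[OF b this] obtain b' where "good b'" "card (?Z b') < card (?Z b)" by blast
    with min[of b'] show False by simp
  qed
  then have "?L b v \<noteq> 0" if "v \<in> V - {q}" for v using that by blast
  then have "\<forall>v\<in>V - {q}. ?L b v > 0" using b by (simp add: good_def order_less_le)
  then show ?thesis using b by (auto simp: good_def)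
qed

section \<open>Reduced divisors and superstable configurations\<close>

text \<open>
  The minimisation runs over firing scripts \<open>s\<close> rather than over divisors: each candidate
  \<open>D - L s\<close> is then linearly equivalent to \<open>D\<close> at once, and set-firing \<open>S\<close> merely adds the
  indicator function of \<open>S\<close> to the script.
\<close>

theorem q_reduced_exists:
  assumes G: "loopless_multigraph V E" and C: "connected_multigraph V E" and q: "q \<in> V"
    and D: "D \<in> carrier (divisor_group V)"
  shows "\<exists>D'. q_reduced V E q D' \<and> linearly_equivalent V E D D'"
proof -
  have fin: "finite V" using G by (simp add: loopless_multigraph_def)
  let ?L = "laplacian V E"
  obtain b0 where b0: "\<forall>v\<in>V. b0 q \<le> b0 v" "\<forall>v\<in>V - {q}. ?L b0 v > 0"
    using strictly_superharmonic_exists[OF G C q] by blast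
  define b where "b v = b0 v - b0 q" for v
  have b: "b q = 0" "\<And>v. v \<in> V \<Longrightarrow> b v \<ge> 0" "\<And>v. v \<in> V - {q} \<Longrightarrow> ?L b v > 0"
    using b0 unfolding b_def laplacian_shift by auto
  \<comment> \<open>Debt at \<open>q\<close> is tolerated; since \<open>b q = 0\<close>, it does not enter the energy.\<close>
  define out_of_debt where "out_of_debt s \<longleftrightarrow> (\<forall>v\<in>V - {q}. D v - ?L s v \<ge> 0)" for s
  define energy where "energy s = (\<Sum>v\<in>V. b v * (D v - ?L s v))" for s
  define k where "k = (\<Sum>v\<in>V. \<bar>D v\<bar>)"
  have "out_of_debt (\<lambda>v. - k * b v)"
    unfolding out_of_debt_def laplacian_scale
  proof
    fix v assume v: "v \<in> V - {q}"
    have "\<bar>D v\<bar> \<le> k" unfolding k_def using fin v by (intro member_le_sum) auto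
    moreover from this have "k \<le> k * ?L b v"
      using b(3)[OF v] mult_left_mono[of 1 "?L b v" k] by linarith
    ultimately show "D v - - k * ?L b v \<ge> 0" by linarith
  qed
  then obtain s where s: "out_of_debt s"
    and min: "\<And>t. out_of_debt t \<Longrightarrow> nat (energy s) \<le> nat (energy t)"
    using ex_has_least_nat[of out_of_debt "\<lambda>v. - k * b v" "\<lambda>s. nat (energy s)"] by metis
  define D' where "D' = (\<lambda>v\<in>V. D v - ?L s v)"
  have nonneg: "D' v \<ge> 0" if "v \<in> V - {q}" for v
    using s that by (simp add: out_of_debt_def D'_def)
  have "\<exists>v\<in>S. set_fire V E S D' v < 0" if S: "S \<noteq> {}" "S \<subseteq> V - {q}" for S
  proof (rule ccontr)
    assume "\<not> ?thesis"
    then have inside: "\<And>v. v \<in> S \<Longrightarrow> set_fire V E S D' v \<ge> 0" by (metis not_less)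
    have SV: "S \<subseteq> V" using S by blast
    let ?t = "\<lambda>v. s v + of_bool (v \<in> S)"
    have fire: "set_fire V E S D' v = D v - ?L ?t v" if "v \<in> V" for v
      using that by (simp add: set_fire_laplacian[OF G SV] D'_def laplacian_add)
    have "set_fire V E S D' v \<ge> 0" if v: "v \<in> V - {q}" for v
    proof (cases "v \<in> S")
      case False
      then have "set_fire V E S D' v \<ge> D' v"
        using set_fire_outside[OF G SV, of v D'] v by simp
      then show ?thesis using nonneg[OF v] by linarith
    qed (rule inside)
    then have t: "out_of_debt ?t"
      unfolding out_of_debt_def using fire by (metis DiffD1)
    have "energy ?t = energy s - (\<Sum>v\<in>V. b v * ?L (\<lambda>v. of_bool (v \<in> S)) v)"
      unfolding energy_def sum_subtractf[symmetric] laplacian_add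
      by (simp add: algebra_simps)
    also have "(\<Sum>v\<in>V. b v * ?L (\<lambda>v. of_bool (v \<in> S)) v) = (\<Sum>v\<in>V. of_bool (v \<in> S) * ?L b v)"
      by (rule laplacian_symmetric)
    also have "\<dots> = (\<Sum>v\<in>S. ?L b v)"
      using fin SV by (intro sum.mono_neutral_cong_right) auto
    finally have "energy ?t = energy s - (\<Sum>v\<in>S. ?L b v)" .
    moreover have "(\<Sum>v\<in>S. ?L b v) > 0"
      using S b(3) finite_subset[OF SV fin] by (intro sum_pos) auto
    moreover have "energy ?t \<ge> 0"
      unfolding energy_def
    proof (rule sum_nonneg)
      fix v assume "v \<in> V"
      then show "b v * (D v - ?L ?t v) \<ge> 0"
        using t b(1,2) by (cases "v = q") (auto simp: out_of_debt_def)
    qed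
    ultimately show False using min[OF t] by linarith
  qed
  moreover have "D' \<in> carrier (divisor_group V)"
    by (simp add: divisor_group_simps D'_def)
  ultimately have "q_reduced V E q D'"
    using nonneg by (simp add: q_reduced_def)
  then show ?thesis
    using linearly_equivalent_laplacian[OF G D, of s] unfolding D'_def by blast
qed

text \<open>
  Inside \<open>S\<close>, set-firing removes from \<open>v\<close> as many chips as there are edges from \<open>v\<close> to \<open>V - S\<close>, so the
  two conditions on \<open>S\<close> coincide. The conversion by \<open>nat\<close> loses nothing because a \<open>q\<close>-reduced
  divisor is nonnegative away from \<open>q\<close>.
\<close>

lemma q_reduced_superstable:
  assumes G: "loopless_multigraph V E" and D: "q_reduced V E q D"
  shows "superstable V E q (\<lambda>v\<in>V - {q}. nat (D v))"
    and "config_divisor V q (\<lambda>v\<in>V - {q}. nat (D v)) (- D q) = D"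
proof -
  let ?c = "\<lambda>v\<in>V - {q}. nat (D v)"
  have nonneg: "\<And>v. v \<in> V - {q} \<Longrightarrow> D v \<ge> 0" and ext: "D \<in> extensional V"
    using D by (auto simp: q_reduced_def divisor_group_simps)
  have "\<exists>v\<in>S. ?c v < size (edges_between E {v} (V - S))" if S: "S \<noteq> {}" "S \<subseteq> V - {q}" for S
  proof -
    from D S obtain v where v: "v \<in> S" "set_fire V E S D v < 0"
      unfolding q_reduced_def by blast
    have "S \<subseteq> V" using S by blast
    from set_fire_inside[OF G this v(1)] v have "D v < int (size (edges_between E {v} (V - S)))"
      by simp
    then show ?thesis using v S nonneg[of v] by (intro bexI[of _ v]) auto
  qed
  then show "superstable V E q ?c"
    by (simp add: superstable_def configurations_def)
  show "config_divisor V q ?c (- D q) = D"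
    by (rule extensionalityI[OF _ ext]) (use nonneg in \<open>auto simp: config_divisor_def\<close>)
qed

theorem corollary4p4:
  fixes V :: "'a set" and E :: "'a set multiset" and D :: "'a \<Rightarrow> int" and q :: 'a
  assumes "loopless_multigraph V E" and "connected_multigraph V E"
    and "D \<in> carrier (divisor_group V)" and "q \<in> V"
  shows "(\<exists>D'. q_reduced V E q D' \<and> linearly_equivalent V E D D') \<and>
         (\<exists>c k. superstable V E q c \<and> linearly_equivalent V E D (config_divisor V q c k))"
proof -
  obtain D' where D': "q_reduced V E q D'" "linearly_equivalent V E D D'"
    using q_reduced_exists[OF assms(1,2,4,3)] by blast
  then show ?thesis
    using q_reduced_superstable[OF assms(1) D'(1)] by metis
qed

end
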